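(* Let $n\ge 1$ and let $f:\mathbb{D}\to\mathbb{G}^n$ be a holomorphic function such that $$\Big(\mathcal{H}_{\mathcal{M}_{\mathbb{D}}}\big(\pi^{-1}(f(x)),\ \pi^{-1}(f(0))\big)\Big)^n=\mathcal{M}_{\mathbb{D}}(x,0)$$ for all $x\in U$, where $U\subset\mathbb{D}$ is a non-empty open subset. Then there is an automorphism $g$ of $\mathbb{D}$ such that $g_{\mathrm{Sym}}\circ f$ is the $n$-th root multi-function, i.e. the map $$z\mapsto \pi(\zeta_1(z),\dots,\zeta_n(z)),$$ where $\zeta_1(z),\dots,\zeta_n(z)\in\mathbb{D}$ are the $n$-th roots of $z$.
   Context: $\mathbb{D}$ is the open unit disk in $\mathbb{C}$. The map $\pi:\mathbb{C}^n\to\mathbb{C}^n$ is $\pi(z)=(\sigma_1(z),\dots,\sigma_n(z))$, where $\sigma_j$ is the $j$-th elementary symmetric polynomial in $n$ variables, and $\mathbb{G}^n:=\pi(\mathbb{D}^n)$ is the symmetrized polydisk, a domain in $\mathbb{C}^n$. For $p=\pi(\lambda_1,\dots,\lambda_n)\in\mathbb{G}^n$, with $\lambda_j\in\mathbb{D}$, the symbol $\pi^{-1}(p)$ denotes the subset $\{\lambda_1,\dots,\lambda_n\}$ of $\mathbb{D}$ (not the fibre in $\mathbb{D}^n$). $\mathcal{M}_{\mathbb{D}}$ is the Möbius distance on $\mathbb{D}$: $\mathcal{M}_{\mathbb{D}}(z,w)=\sup\{|\phi(z)|:\phi:\mathbb{D}\to\mathbb{D}\text{ holomorphic},\ \phi(w)=0\}=\left|\frac{z-w}{1-\overline{w}z}\right|$.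 For non-empty finite $A,B\subset\mathbb{D}$, $\mathcal{H}_{\mathcal{M}_{\mathbb{D}}}(A,B):=\max\{\max_{a\in A}\min_{b\in B}\mathcal{M}_{\mathbb{D}}(a,b),\ \max_{b\in B}\min_{a\in A}\mathcal{M}_{\mathbb{D}}(a,b)\}$ is the Hausdorff distance. For an automorphism (biholomorphic self-map) $g$ of $\mathbb{D}$, $g_{\mathrm{Sym}}:\mathbb{G}^n\to\mathbb{G}^n$ is the induced map $\pi(\lambda_1,\dots,\lambda_n)\mapsto\pi(g(\lambda_1),\dots,g(\lambda_n))$. The $n$-th roots of $z$ are listed with multiplicity (all equal to $0$ when $z=0$). *)

theory Defs
  imports "HOL-Complex_Analysis.Complex_Analysis"
begin

text \<open>
  Points of the \<open>n\<close>-dimensional complex space are lists of length \<open>n\<close> over \<^typ>\<open>complex\<close>, so that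
  \<open>n\<close> is an ordinary natural number. The unit disc is \<^term>\<open>ball (0::complex) 1\<close>.
\<close>

definition polydisk :: "nat \<Rightarrow> complex list set" where
  "polydisk n = {zs. length zs = n \<and> set zs \<subseteq> ball 0 1}"

definition elem_sym :: "nat \<Rightarrow> complex list \<Rightarrow> complex" where
  "elem_sym j zs = (\<Sum>I | I \<subseteq> {..<length zs} \<and> card I = j. \<Prod>i\<in>I. zs ! i)"

definition sym_map :: "complex list \<Rightarrow> complex list" where
  "sym_map zs = map (\<lambda>j. elem_sym j zs) [1..<length zs + 1]"

definition sym_polydisk :: "nat \<Rightarrow> complex list set" where
  "sym_polydisk n = sym_map ` polydisk n"

text \<open>A map into lists of length \<open>n\<close> is holomorphic if all its coordinate functions are.\<close>

definition holomorphic_map :: "nat \<Rightarrow> (complex \<Rightarrow> complex list) \<Rightarrow> complex set \<Rightarrow> bool" where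
  "holomorphic_map n f S \<longleftrightarrow>
     (\<forall>z\<in>S. length (f z) = n) \<and> (\<forall>i<n. (\<lambda>z. f z ! i) holomorphic_on S)"

text \<open>
  The two definite descriptions below are meant for points of \<^term>\<open>sym_polydisk n\<close>, where they
  are well defined because \<^term>\<open>sym_map zs\<close> determines \<open>zs\<close> up to order; see the lemmas
  \<open>sym_preimage_sym_map\<close> and \<open>sym_lift_sym_map\<close>. The first is the subset
  \<open>{\<lambda>\<^sub>1, \<dots>, \<lambda>\<^sub>n}\<close> of the disc, not the fibre in the polydisk.
\<close>

definition sym_preimage :: "complex list \<Rightarrow> complex set" where
  "sym_preimage p = (THE A. \<exists>zs\<in>polydisk (length p). sym_map zs = p \<and> A = set zs)"

definition sym_lift :: "(complex \<Rightarrow> complex) \<Rightarrow> complex list \<Rightarrow> complex list" where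
  "sym_lift g p =
     (THE q. \<exists>zs\<in>polydisk (length p). sym_map zs = p \<and> q = sym_map (map g zs))"

definition moebius_dist :: "complex \<Rightarrow> complex \<Rightarrow> real" where
  "moebius_dist z w =
     Sup {cmod (\<phi> z) | \<phi>. \<phi> holomorphic_on ball 0 1 \<and> \<phi> ` ball 0 1 \<subseteq> ball 0 1 \<and> \<phi> w = 0}"

text \<open>Meant for non-empty finite sets, so that all minima and maxima exist.\<close>

definition hausdorff_dist :: "('a \<Rightarrow> 'a \<Rightarrow> real) \<Rightarrow> 'a set \<Rightarrow> 'a set \<Rightarrow> real" where
  "hausdorff_dist d A B =
     max (Max ((\<lambda>a. Min ((\<lambda>b. d a b) ` B)) ` A)) (Max ((\<lambda>b. Min ((\<lambda>a. d a b) ` A)) ` B))"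

definition disc_automorphism :: "(complex \<Rightarrow> complex) \<Rightarrow> bool" where
  "disc_automorphism g \<longleftrightarrow>
     g holomorphic_on ball 0 1 \<and> bij_betw g (ball 0 1) (ball 0 1) \<and>
     inv_into (ball 0 1) g holomorphic_on ball 0 1"

text \<open>\<open>\<zeta>s\<close> lists the \<open>n\<close>-th roots of \<open>z\<close>, i.e. the roots of \<open>X^n - z\<close>, with multiplicity.\<close>

definition lists_nth_roots :: "nat \<Rightarrow> complex \<Rightarrow> complex list \<Rightarrow> bool" where
  "lists_nth_roots n z \<zeta>s \<longleftrightarrow> mset \<zeta>s = proots (monom 1 n - [:z:])"

lemma prod_linear_factors_elem_sym:
  "(\<Prod>z\<leftarrow>zs. w + z) = (\<Sum>j\<le>length zs. elem_sym j zs * w ^ (length zs - j))"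
proof -
  let ?n = "length zs"
  have "(\<Prod>z\<leftarrow>zs. w + z) = (\<Prod>i<?n. zs ! i + w)"
    by (simp add: prod.list_conv_set_nth atLeast0LessThan add.commute)
  also have "\<dots> = (\<Sum>I\<in>Pow {..<?n}. (\<Prod>i\<in>I. zs ! i) * (\<Prod>i\<in>{..<?n} - I. w))"
    by (rule prod_add) simp
  also have "\<dots> = (\<Sum>I\<in>Pow {..<?n}. (\<Prod>i\<in>I. zs ! i) * w ^ (?n - card I))"
    by (intro sum.cong refl) (auto simp: card_Diff_subset finite_subset [OF _ finite_lessThan])
  also have "\<dots> = (\<Sum>j\<le>?n. \<Sum>I | I \<in> Pow {..<?n} \<and> card I = j.
      (\<Prod>i\<in>I. zs ! i) * w ^ (?n - card I))"
    by (rule sum.group [symmetric])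
      (auto, metis card_lessThan card_mono finite_lessThan)
  also have "\<dots> = (\<Sum>j\<le>?n. elem_sym j zs * w ^ (?n - j))"
    unfolding elem_sym_def sum_distrib_right by (intro sum.cong) auto
  finally show ?thesis .
qed

lemma elem_sym_0 [simp]: "elem_sym 0 zs = 1"
proof -
  have "{I. I \<subseteq> {..<length zs} \<and> card I = 0} = {{}}"
    by (auto dest: finite_subset [OF _ finite_lessThan])
  then show ?thesis by (simp add: elem_sym_def)
qed

lemma length_sym_map [simp]: "length (sym_map zs) = length zs"
  by (simp add: sym_map_def del: upt_Suc)

lemma sym_map_eq_iff: "sym_map xs = sym_map ys \<longleftrightarrow> mset xs = mset ys"
proof
  assume eq: "sym_map xs = sym_map ys"
  have len: "length xs = length ys"
    using arg_cong [OF eq, of length] by simp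
  have es: "elem_sym j xs = elem_sym j ys" if "j \<le> length xs" for j
  proof (cases j)
    case (Suc k)
    then have "sym_map xs ! k = sym_map ys ! k" "k < length xs" "k < length ys"
      using eq that len by auto
    then show ?thesis using Suc by (simp add: sym_map_def del: upt_Suc)
  qed simp
  have pw: "(\<Prod>z\<leftarrow>xs. w + z) = (\<Prod>z\<leftarrow>ys. w + z)" for w
    unfolding prod_linear_factors_elem_sym using len es by (auto intro!: sum.cong)
  have pol: "poly (\<Prod>z\<leftarrow>zs. [:-z, 1:]) w = (-1) ^ length zs * (\<Prod>z\<leftarrow>zs. -w + z)"
    for zs and w :: complex
    by (induction zs) (auto simp: algebra_simps)
  have "(\<Prod>z\<leftarrow>xs. [:-z, 1:]) = (\<Prod>z\<leftarrow>ys. [:-z, 1:])"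
    by (subst poly_eq_poly_eq_iff [symmetric]) (rule ext, simp only: pol pw len)
  moreover have "proots (\<Prod>z\<leftarrow>zs. [:-z, 1:]) = mset zs" for zs :: "complex list"
  proof (induction zs)
    case (Cons a zs)
    have "(\<Prod>z\<leftarrow>zs. [:-z, 1:]) \<noteq> 0"
      by (auto simp: prod_list_zero_iff)
    with Cons show ?case by (simp add: proots_mult del: mult_pCons_left)
  qed simp
  ultimately show "mset xs = mset ys" by metis
next
  assume ms: "mset xs = mset ys"
  have len: "length xs = length ys" using ms by (metis size_mset)
  have "(\<Prod>z\<leftarrow>xs. w + z) = (\<Prod>z\<leftarrow>ys. w + z)" for w
    using ms by (metis mset_map prod_mset_prod_list)
  moreover have "(\<Prod>z\<leftarrow>zs. w + z) = (\<Sum>j\<le>length zs. elem_sym (length zs - j) zs * w ^ j)" for zs w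
    unfolding prod_linear_factors_elem_sym
    by (rule sum.reindex_bij_witness [of _ "\<lambda>j. length zs - j" "\<lambda>j. length zs - j"]) auto
  ultimately have "\<forall>w. (\<Sum>j\<le>length xs. elem_sym (length xs - j) xs * w ^ j) =
      (\<Sum>j\<le>length xs. elem_sym (length xs - j) ys * w ^ j)"
    by (metis len)
  then have "\<forall>j\<le>length xs. elem_sym (length xs - j) xs = elem_sym (length xs - j) ys"
    by (subst (asm) polyfun_eq_coeffs)
  then have "elem_sym j xs = elem_sym j ys" if "j \<le> length xs" for j
    using that by (metis diff_diff_cancel diff_le_self)
  then show "sym_map xs = sym_map ys"
    by (auto simp: sym_map_def len)
qed

lemma sym_preimage_sym_map:
  assumes "zs \<in> polydisk n"
  shows "sym_preimage (sym_map zs) = set zs"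
  unfolding sym_preimage_def using assms
  by (intro the_equality) (auto simp: polydisk_def sym_map_eq_iff dest: mset_eq_setD)

lemma sym_lift_sym_map:
  assumes "zs \<in> polydisk n"
  shows "sym_lift g (sym_map zs) = sym_map (map g zs)"
  unfolding sym_lift_def using assms
  by (intro the_equality) (auto simp: polydisk_def sym_map_eq_iff)

lemma moebius_dist_eq:
  assumes z: "z \<in> ball 0 1" and w: "w \<in> ball 0 1"
  shows "moebius_dist z w = cmod ((z - w) / (1 - cnj w * z))"
  unfolding moebius_dist_def
proof (rule cSup_eq_maximum)
  let ?m = "Moebius_function 0 w" and ?m' = "Moebius_function 0 (-w)"
  have "?m holomorphic_on ball 0 1" "?m ` ball 0 1 \<subseteq> ball 0 1" "?m w = 0"
    using w by (auto simp: Moebius_function_holomorphic Moebius_function_norm_lt_1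
        Moebius_function_eq_zero)
  then show "cmod ((z - w) / (1 - cnj w * z)) \<in> {cmod (\<phi> z) | \<phi>. \<phi> holomorphic_on ball 0 1 \<and>
      \<phi> ` ball 0 1 \<subseteq> ball 0 1 \<and> \<phi> w = 0}"
    unfolding mem_Collect_eq Moebius_function_simple [symmetric] by blast
  fix r
  assume "r \<in> {cmod (\<phi> z) | \<phi>. \<phi> holomorphic_on ball 0 1 \<and>
      \<phi> ` ball 0 1 \<subseteq> ball 0 1 \<and> \<phi> w = 0}"
  then obtain \<phi> where r: "r = cmod (\<phi> z)" and hol: "\<phi> holomorphic_on ball 0 1"
    and im: "\<phi> ` ball 0 1 \<subseteq> ball 0 1" and 0: "\<phi> w = 0" by auto
  have m'im: "?m' ` ball 0 1 \<subseteq> ball 0 1"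
    using w by (auto simp: Moebius_function_norm_lt_1)
  have "cmod ((\<phi> \<circ> ?m') (?m z)) \<le> cmod (?m z)"
  proof (rule Schwarz_Lemma(1))
    show "(\<phi> \<circ> ?m') holomorphic_on ball 0 1"
      using w hol m'im
      by (intro holomorphic_on_compose_gen [where t = "ball 0 1"] Moebius_function_holomorphic) auto
    show "(\<phi> \<circ> ?m') 0 = 0" by (simp add: Moebius_function_of_zero 0)
    show "cmod ((\<phi> \<circ> ?m') x) < 1" if "cmod x < 1" for x
      using that im m'im by (force simp: image_subset_iff)
    show "cmod (?m z) < 1" using z w by (auto intro: Moebius_function_norm_lt_1)
  qed
  moreover have "?m' (?m z) = z"
    using z w by (intro Moebius_function_compose) auto
  ultimately show "r \<le> cmod ((z - w) / (1 - cnj w * z))"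
    by (simp add: r Moebius_function_simple)
qed

lemma lists_nth_roots_iff:
  assumes "n \<ge> 1"
  shows "lists_nth_roots n z \<zeta>s \<longleftrightarrow>
    (if z = 0 then \<zeta>s = replicate n 0 else distinct \<zeta>s \<and> set \<zeta>s = {w. w ^ n = z})"
proof (cases "z = 0")
  case True
  have "monom (1::complex) n = [:0, 1:] ^ n" by (simp add: monom_altdef)
  then have "proots (monom (1::complex) n) = replicate_mset n 0"
    by (auto simp: proots_power repeat_mset_replicate_mset multiset_eq_iff)
  then show ?thesis
    using True mset_eq_setD [of \<zeta>s "replicate n 0"]
    by (auto simp: lists_nth_roots_def)
      (metis mset_replicate in_set_replicate mset_eq_length mset_eq_setD length_replicate
        replicate_length_same)
next
  case False
  let ?p = "monom 1 n - [:z:]"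
  have p: "poly ?p w = w ^ n - z" for w by (simp add: poly_monom)
  have "coeff ?p n = 1" using assms by (cases n) auto
  then have p0: "?p \<noteq> 0" by (metis coeff_0 zero_neq_one)
  have "count (proots ?p) w = (if w ^ n = z then 1 else 0)" for w
  proof (cases "w ^ n = z")
    case True
    have "w \<noteq> 0" using True False assms by (auto simp: power_0_left)
    then have "poly (pderiv ?p) w \<noteq> 0"
      using assms by (simp add: pderiv_diff pderiv_monom poly_monom)
    then have "order w ?p = 1"
      using p0 p True by (metis order_root order_pderiv[of ?p w] diff_self
          One_nat_def order_0I)
    then show ?thesis using p0 True by simp
  next
    case False
    then show ?thesis using p0 p [of w] by (simp add: order_0I)
  qed
  then have "mset \<zeta>s = proots ?p \<longleftrightarrow> (\<forall>w. count (mset \<zeta>s) w = (if w ^ n = z then 1 else 0))"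
    by (auto simp: multiset_eq_iff)
  also have "\<dots> \<longleftrightarrow> distinct \<zeta>s \<and> set \<zeta>s = {w. w ^ n = z}"
  proof
    assume *: "\<forall>w. count (mset \<zeta>s) w = (if w ^ n = z then 1 else 0)"
    have s: "w \<in> set \<zeta>s \<longleftrightarrow> w ^ n = z" for w
      using spec [OF *, of w] count_mset_0_iff [of \<zeta>s w] by (auto split: if_splits)
    have "distinct \<zeta>s" unfolding distinct_count_atmost_1 using * s by presburger
    with s show "distinct \<zeta>s \<and> set \<zeta>s = {w. w ^ n = z}"
      by blast
  next
    assume "distinct \<zeta>s \<and> set \<zeta>s = {w. w ^ n = z}"
    then show "\<forall>w. count (mset \<zeta>s) w = (if w ^ n = z then 1 else 0)"
      by (metis distinct_count_atmost_1 mem_Collect_eq)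
  qed
  finally show ?thesis using False by (simp add: lists_nth_roots_def)
qed

end

theory Submission
  imports Defs
begin

text \<open>
  Write \<open>f z = sym_map (L z)\<close>, where \<open>L z\<close> lists the points of the disc that \<open>f z\<close> encodes, called
  the values at \<open>z\<close>. For a value \<open>b\<close> at \<open>x\<close>, the product of \<open>moebius b l\<close> over the values \<open>l\<close> at \<open>z\<close>
  is a holomorphic self-map of the disc which vanishes at \<open>x\<close>. The Schwarz lemma therefore bounds
  the product of the distances of \<open>b\<close> from the values at \<open>z\<close> by the distance of \<open>z\<close> and \<open>x\<close>
  (\<open>prod_moebius_dist_le\<close>). With one of the points \<open>z\<close> and \<open>x\<close> equal to \<open>0\<close>, this gives the
  inequality whose equality case is the hypothesis. Hence at every \<open>x\<close> in \<open>U\<close> other than \<open>0\<close>, either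
  some value at \<open>x\<close> has distance exactly \<open>root n (cmod x)\<close> from all values at \<open>0\<close>, or some value at
  \<open>0\<close> has this distance from all values at \<open>x\<close> (\<open>equidistant_root\<close>).

  Since these alternatives cover an open set, the values at \<open>0\<close> all coincide (\<open>root_set_singleton\<close>).
  Otherwise, while \<open>x\<close> runs over an arc of points of equal modulus, the first alternative confines a
  value at \<open>x\<close> to the finite intersection of two distinct circles, so that a fixed point is a value at
  infinitely many \<open>x\<close>, hence everywhere, which is impossible. In the second alternative the
  polynomial with the recentred values as roots is self-inversive with respect to the circle of radius
  \<open>root n (cmod x)\<close>; if this holds for all \<open>x\<close> in an open set, then its coefficients, apart from the
  leading one, vanish at \<open>0\<close>.

  Once the only value at \<open>0\<close> has been moved to \<open>0\<close> by a Moebius transformation, every value \<open>l\<close> at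
  \<open>z\<close> satisfies \<open>cmod l ^ n \<le> cmod z\<close>, with equality for some \<open>l\<close> and some \<open>z\<close> other than \<open>0\<close>. The
  theorem of Hurwitz turns this one equality into the identity that \<open>v * w\<close> is a value at \<open>w ^ n\<close> for
  all \<open>w\<close>, with a fixed \<open>v\<close> of modulus one (\<open>extremal_root_family\<close>). Undoing the rotation by \<open>v\<close>
  makes the values the \<open>n\<close>-th roots of \<open>z\<close>.
\<close>

section \<open>Elementary symmetric functions\<close>

lemma elem_sym_map_mult: "elem_sym j (map ((*) c) zs) = c ^ j * elem_sym j zs"
proof -
  have "(\<Prod>i\<in>I. map ((*) c) zs ! i) = c ^ j * (\<Prod>i\<in>I. zs ! i)"
    if "I \<subseteq> {..<length zs}" "card I = j" for I
  proof -
    have "(\<Prod>i\<in>I. map ((*) c) zs ! i) = (\<Prod>i\<in>I. c * zs ! i)"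
      using that by (intro prod.cong) auto
    then show ?thesis using that by (simp add: prod.distrib)
  qed
  then show ?thesis
    unfolding elem_sym_def sum_distrib_left by (intro sum.cong) auto
qed

lemma prod_list_diff_elem_sym:
  "(\<Prod>z\<leftarrow>zs. \<alpha> - \<beta> * z) =
    (\<Sum>j\<le>length zs. (- \<beta>) ^ j * elem_sym j zs * \<alpha> ^ (length zs - j))"
  using prod_linear_factors_elem_sym[of \<alpha> "map ((*) (- \<beta>)) zs"]
  by (simp add: elem_sym_map_mult o_def)

lemma elem_sym_length: "elem_sym (length zs) zs = prod_list zs"
proof -
  have "{I. I \<subseteq> {..<length zs} \<and> card I = length zs} = {{..<length zs}}"
    by (auto dest: card_subset_eq[rotated])
  then show ?thesis
    by (simp add: elem_sym_def prod.list_conv_set_nth atLeast0LessThan)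
qed

lemma eq_0_if_elem_sym_eq_0:
  assumes "\<And>j. 1 \<le> j \<Longrightarrow> j \<le> length zs \<Longrightarrow> elem_sym j zs = 0" "z \<in> set zs"
  shows "z = 0"
proof -
  have "0 = (\<Prod>w\<leftarrow>zs. z - 1 * w)"
    using assms(2) by (simp add: prod_list_zero_iff image_iff)
  also have "\<dots> = (\<Sum>j\<le>length zs. if j = 0 then z ^ length zs else 0)"
    unfolding prod_list_diff_elem_sym using assms(1) by (intro sum.cong) auto
  also have "\<dots> = z ^ length zs" by simp
  finally show ?thesis by simp
qed

text \<open>
  If all entries have modulus \<open>s\<close>, then \<open>z * cnj z = s\<^sup>2\<close> for each of them, so conjugating a product
  over \<open>j\<close> of the entries turns it, up to the product of all entries, into the product over the other
  ones. Thus \<open>\<Prod> (X - z)\<close> is self-inversive with respect to the circle of radius \<open>s\<close>; this is how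
  a condition on the moduli of the roots is read off from the coefficients.
\<close>

lemma elem_sym_reflect:
  fixes s :: real
  assumes norm: "\<And>z. z \<in> set zs \<Longrightarrow> cmod z = s" and j: "j \<le> length zs"
  shows "cnj (elem_sym j zs) * prod_list zs = of_real (s ^ (2 * j)) * elem_sym (length zs - j) zs"
proof -
  let ?n = "length zs"
  have flip: "cnj (\<Prod>i\<in>I. zs ! i) * prod_list zs = of_real (s ^ (2 * j)) * (\<Prod>i\<in>{..<?n} - I. zs ! i)"
    if I: "I \<subseteq> {..<?n}" "card I = j" for I
  proof -
    have "prod_list zs = (\<Prod>i\<in>{..<?n} - I. zs ! i) * (\<Prod>i\<in>I. zs ! i)"
      using I by (simp add: prod.list_conv_set_nth atLeast0LessThan prod.subset_diff)
    then have "cnj (\<Prod>i\<in>I. zs ! i) * prod_list zs =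
        (\<Prod>i\<in>I. zs ! i * cnj (zs ! i)) * (\<Prod>i\<in>{..<?n} - I. zs ! i)"
      by (simp add: prod.distrib)
    also have "(\<Prod>i\<in>I. zs ! i * cnj (zs ! i)) = (\<Prod>i\<in>I. of_real (s\<^sup>2))"
      using I norm by (intro prod.cong) (auto simp: complex_norm_square [symmetric])
    finally show ?thesis using I by (simp add: power_mult)
  qed
  have "cnj (elem_sym j zs) * prod_list zs =
      (\<Sum>I | I \<subseteq> {..<?n} \<and> card I = j. of_real (s ^ (2 * j)) * (\<Prod>i\<in>{..<?n} - I. zs ! i))"
    unfolding elem_sym_def cnj_sum sum_distrib_right using flip by (intro sum.cong) auto
  also have "\<dots> = (\<Sum>I | I \<subseteq> {..<?n} \<and> card I = ?n - j. of_real (s ^ (2 * j)) * (\<Prod>i\<in>I. zs ! i))"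
    using j by (intro sum.reindex_bij_witness[of _ "\<lambda>I. {..<?n} - I" "\<lambda>I. {..<?n} - I"])
      (auto simp: card_Diff_subset finite_subset[OF _ finite_lessThan])
  finally show ?thesis by (simp add: elem_sym_def sum_distrib_left)
qed

section \<open>Moebius transformations of the disc\<close>

abbreviation moebius :: "complex \<Rightarrow> complex \<Rightarrow> complex" where
  "moebius a \<equiv> Moebius_function 0 a"

lemma moebius_denominator_nonzero:
  assumes "cmod a < 1" "cmod z < 1"
  shows "1 - cnj a * z \<noteq> 0"
proof
  assume "1 - cnj a * z = 0"
  then have "cmod (cnj a * z) = 1" by (metis eq_iff_diff_eq_0 norm_one)
  moreover have "cmod (cnj a * z) < 1" using norm_mult_less[of "cnj a" 1 z 1] assms by simp
  ultimately show False by simp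
qed

lemma moebius_dist_eq_cmod_moebius:
  "cmod a < 1 \<Longrightarrow> cmod z < 1 \<Longrightarrow> moebius_dist z a = cmod (moebius a z)"
  by (simp add: moebius_dist_eq Moebius_function_simple)

lemma moebius_dist_commute:
  assumes "cmod a < 1" "cmod z < 1"
  shows "moebius_dist z a = moebius_dist a z"
proof -
  have "cmod (1 - cnj a * z) = cmod (cnj (1 - cnj a * z))" by (simp only: complex_mod_cnj)
  then show ?thesis using assms by (simp add: moebius_dist_eq norm_divide norm_minus_commute mult.commute)
qed

lemma moebius_eq_iff:
  assumes "cmod a < 1" "cmod z < 1" "cmod w < 1"
  shows "moebius a z = moebius a w \<longleftrightarrow> z = w"
  using Moebius_function_compose[of "-a" a] assms by (metis minus_minus norm_minus_cancel)

lemma moebius_eq_0_iff: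
  "cmod a < 1 \<Longrightarrow> cmod z < 1 \<Longrightarrow> moebius a z = 0 \<longleftrightarrow> z = a"
  using moebius_denominator_nonzero by (auto simp: Moebius_function_simple)

lemma disc_automorphism_rotated_moebius:
  assumes a: "cmod a < 1" and \<kappa>: "cmod \<kappa> = 1"
  shows "disc_automorphism (\<lambda>z. \<kappa> * moebius a z)"
proof -
  let ?g = "\<lambda>z. \<kappa> * moebius a z" and ?h = "\<lambda>z. moebius (- a) (z / \<kappa>)"
  have \<kappa>0: "\<kappa> \<noteq> 0" using \<kappa> by auto
  have g: "cmod (?g z) < 1" if "cmod z < 1" for z
    using Moebius_function_norm_lt_1[OF a that] \<kappa> by (simp add: norm_mult)
  have h: "cmod (?h z) < 1" if "cmod z < 1" for z
    using Moebius_function_norm_lt_1[of "-a" "z / \<kappa>"] a \<kappa> that by (simp add: norm_divide)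
  have hg: "?h (?g z) = z" if "cmod z < 1" for z
    using Moebius_function_compose[of "-a" a z] a that \<kappa>0 by simp
  have gh: "?g (?h z) = z" if "cmod z < 1" for z
    using Moebius_function_compose[of "a" "-a" "z / \<kappa>"] a that \<kappa>0 \<kappa> by (simp add: norm_divide)
  have bij: "bij_betw ?g (ball 0 1) (ball 0 1)"
    by (rule bij_betwI[of _ _ _ ?h]) (use g h hg gh in auto)
  have "moebius (- a) \<circ> (\<lambda>z. z / \<kappa>) holomorphic_on ball 0 1"
    using a \<kappa> \<kappa>0 by (intro holomorphic_on_compose_gen[where t = "ball 0 1"] Moebius_function_holomorphic holomorphic_intros)
      (auto simp: norm_divide)
  moreover have "inv_into (ball 0 1) ?g z = ?h z" if "z \<in> ball 0 1" for z
    using bij that gh h by (intro inv_into_f_eq) (auto simp: bij_betw_def)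
  ultimately have "inv_into (ball 0 1) ?g holomorphic_on ball 0 1"
    by (auto simp: o_def intro: holomorphic_transform)
  then show ?thesis
    using bij a unfolding disc_automorphism_def by (auto intro!: holomorphic_intros Moebius_function_holomorphic)
qed

lemma finite_Re_cmod_fixed: "finite {u. Re u = k \<and> cmod u = l}"
proof (rule finite_subset)
  show "{u. Re u = k \<and> cmod u = l} \<subseteq> {Complex k (sqrt (l\<^sup>2 - k\<^sup>2)), Complex k (- sqrt (l\<^sup>2 - k\<^sup>2))}"
  proof
    fix u assume "u \<in> {u. Re u = k \<and> cmod u = l}"
    then have u: "Re u = k" "cmod u = l" by auto
    then have "(Im u)\<^sup>2 = l\<^sup>2 - k\<^sup>2" using cmod_power2[of u] by simp
    then have "sqrt (l\<^sup>2 - k\<^sup>2) = \<bar>Im u\<bar>" by (metis real_sqrt_abs)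
    then show "u \<in> {Complex k (sqrt (l\<^sup>2 - k\<^sup>2)), Complex k (- sqrt (l\<^sup>2 - k\<^sup>2))}"
      using u by (auto simp: complex_eq_iff abs_if)
  qed
qed simp

text \<open>
  The points in question lie on the intersection of two distinct circles: once \<open>cmod b = s\<close> is
  inserted, the condition \<open>cmod (moebius \<nu> b) = s\<close> becomes linear in \<open>b\<close> and fixes
  \<open>Re (cnj \<nu> * b)\<close>.
\<close>

lemma finite_moebius_equidistant_0:
  assumes \<nu>: "cmod \<nu> < 1" "\<nu> \<noteq> 0" and s: "s < 1"
  shows "finite {b. cmod b < 1 \<and> cmod b = s \<and> cmod (moebius \<nu> b) = s}"
proof -
  let ?k = "(s\<^sup>2 + (cmod \<nu>)\<^sup>2 - s\<^sup>2 * (1 + (cmod \<nu>)\<^sup>2 * s\<^sup>2)) / (2 * (1 - s\<^sup>2))"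
  have "Re (cnj \<nu> * b) = ?k \<and> cmod (cnj \<nu> * b) = cmod \<nu> * s"
    if b: "cmod b < 1" "cmod b = s" "cmod (moebius \<nu> b) = s" for b
  proof -
    have "0 \<le> s" using b by auto
    then have s2: "1 - s\<^sup>2 > 0" using s by (simp add: abs_square_less_1)
    have "cmod (b - \<nu>) = s * cmod (1 - cnj \<nu> * b)"
      using b \<nu> moebius_denominator_nonzero[of \<nu> b]
      by (simp add: Moebius_function_simple norm_divide divide_eq_eq)
    then have "(cmod (b - \<nu>))\<^sup>2 = s\<^sup>2 * (cmod (1 - cnj \<nu> * b))\<^sup>2" by (simp add: power_mult_distrib)
    moreover have "(cmod (b - \<nu>))\<^sup>2 = (cmod b)\<^sup>2 + (cmod \<nu>)\<^sup>2 - 2 * Re (cnj \<nu> * b)"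
      by (simp add: cmod_power2) (simp add: power2_eq_square algebra_simps)
    moreover have "(cmod (1 - cnj \<nu> * b))\<^sup>2 = 1 + (cmod \<nu>)\<^sup>2 * (cmod b)\<^sup>2 - 2 * Re (cnj \<nu> * b)"
      by (simp add: cmod_power2) (simp add: power2_eq_square algebra_simps)
    ultimately have "s\<^sup>2 + (cmod \<nu>)\<^sup>2 - 2 * Re (cnj \<nu> * b) =
        s\<^sup>2 * (1 + (cmod \<nu>)\<^sup>2 * s\<^sup>2 - 2 * Re (cnj \<nu> * b))" using b by metis
    then have "2 * (1 - s\<^sup>2) * Re (cnj \<nu> * b) = s\<^sup>2 + (cmod \<nu>)\<^sup>2 - s\<^sup>2 * (1 + (cmod \<nu>)\<^sup>2 * s\<^sup>2)"
      by (simp add: algebra_simps del: times_complex.sel)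
    then have "Re (cnj \<nu> * b) = ?k" using s2
      by (metis less_irrefl mult_eq_0_iff nonzero_mult_div_cancel_left zero_neq_numeral)
    then show ?thesis using b by (simp add: norm_mult)
  qed
  then have "(\<lambda>b. cnj \<nu> * b) ` {b. cmod b < 1 \<and> cmod b = s \<and> cmod (moebius \<nu> b) = s} \<subseteq>
      {u. Re u = ?k \<and> cmod u = cmod \<nu> * s}" by blast
  then have "finite ((\<lambda>b. cnj \<nu> * b) ` {b. cmod b < 1 \<and> cmod b = s \<and> cmod (moebius \<nu> b) = s})"
    using finite_Re_cmod_fixed finite_subset by blast
  then show ?thesis
    by (rule finite_imageD) (use \<nu> in \<open>auto simp: inj_on_def\<close>)
qed

text \<open>
  Moebius transformations are isometries of the Moebius distance. This lets any point of the disc be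
  moved to the origin.
\<close>

lemma moebius_dist_moebius:
  assumes "cmod a < 1" "cmod z < 1" "cmod w < 1"
  shows "moebius_dist (moebius a z) (moebius a w) = moebius_dist z w"
proof -
  have nz: "1 - cnj a * z \<noteq> 0" "1 - cnj a * w \<noteq> 0" "1 - a * cnj w \<noteq> 0" "1 - cnj w * z \<noteq> 0" "1 - cnj a * a \<noteq> 0"
    using assms moebius_denominator_nonzero[of a] moebius_denominator_nonzero[of w z] 
       moebius_denominator_nonzero[of w a] by (auto simp: mult.commute)
  have 1: "moebius a z - moebius a w = (1 - cnj a * a) * (z - w) / ((1 - cnj a * z) * (1 - cnj a * w))"
    using nz by (simp add: Moebius_function_simple field_simps)
  have 2: "1 - cnj (moebius a w) * moebius a z = (1 - cnj a * a) * (1 - cnj w * z) / ((1 - cnj a * z) * (1 - a * cnj w))"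
    using nz by (simp add: Moebius_function_simple divide_simps) (simp add: algebra_simps)
  have "cmod (1 - a * cnj w) = cmod (cnj (1 - a * cnj w))" by (simp only: complex_mod_cnj)
  then have "cmod (1 - a * cnj w) = cmod (1 - cnj a * w)" by simp
  then have "cmod ((moebius a z - moebius a w) / (1 - cnj (moebius a w) * moebius a z)) = cmod ((z - w) / (1 - cnj w * z))"
    unfolding 1 2 norm_divide norm_mult using nz by (simp add: field_simps)
  then show ?thesis
    using assms by (simp add: moebius_dist_eq Moebius_function_norm_lt_1)
qed

lemma finite_moebius_equidistant:
  assumes a: "cmod a < 1" "cmod a' < 1" "a \<noteq> a'" and s: "s < 1"
  shows "finite {b. cmod b < 1 \<and> moebius_dist b a = s \<and> moebius_dist b a' = s}" (is "finite ?B")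
proof -
  have "moebius a ` ?B \<subseteq> {b. cmod b < 1 \<and> cmod b = s \<and> cmod (moebius (moebius a a') b) = s}"
  proof clarify
    fix b assume b: "cmod b < 1" "s = moebius_dist b a" "moebius_dist b a' = moebius_dist b a"
    have "cmod (moebius (moebius a a') (moebius a b)) = moebius_dist b a'"
      using a b moebius_dist_eq_cmod_moebius[of "moebius a a'" "moebius a b"]
      by (simp add: moebius_dist_moebius Moebius_function_norm_lt_1)
    then show "cmod (moebius a b) < 1 \<and> cmod (moebius a b) = moebius_dist b a \<and>
         cmod (moebius (moebius a a') (moebius a b)) = moebius_dist b a"
      using a b by (auto simp: moebius_dist_eq_cmod_moebius Moebius_function_norm_lt_1)
  qed
  moreover have "finite {b. cmod b < 1 \<and> cmod b = s \<and> cmod (moebius (moebius a a') b) = s}"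
    by (rule finite_moebius_equidistant_0) (use a s moebius_eq_0_iff in \<open>auto simp: Moebius_function_norm_lt_1\<close>)
  ultimately have "finite (moebius a ` ?B)" by (rule finite_subset)
  then show ?thesis
    by (rule finite_imageD) (use a moebius_eq_iff in \<open>auto simp: inj_on_def\<close>)
qed

section \<open>Holomorphic families of root lists\<close>

text \<open>
  A holomorphic map into the symmetrized polydisk, seen as an \<open>n\<close>-valued function. The order in which
  the values are listed may jump with \<open>z\<close>, so that no single entry is expected to be continuous;
  only symmetric expressions in the values are holomorphic.
\<close>

definition holomorphic_root_family :: "nat \<Rightarrow> (complex \<Rightarrow> complex list) \<Rightarrow> bool" where
  "holomorphic_root_family n L \<longleftrightarrow> L ` ball 0 1 \<subseteq> polydisk n \<and>
     (\<forall>j\<le>n. (\<lambda>z. elem_sym j (L z)) holomorphic_on ball 0 1)"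

lemma holomorphic_root_familyD:
  assumes "holomorphic_root_family n L"
  shows "\<And>z. cmod z < 1 \<Longrightarrow> length (L z) = n"
    and "\<And>z b. cmod z < 1 \<Longrightarrow> b \<in> set (L z) \<Longrightarrow> cmod b < 1"
    and "\<And>j. j \<le> n \<Longrightarrow> (\<lambda>z. elem_sym j (L z)) holomorphic_on ball 0 1"
proof -
  have "L z \<in> polydisk n" if "cmod z < 1" for z
    using assms that unfolding holomorphic_root_family_def by (simp add: image_subset_iff)
  then show "\<And>z. cmod z < 1 \<Longrightarrow> length (L z) = n"
    and "\<And>z b. cmod z < 1 \<Longrightarrow> b \<in> set (L z) \<Longrightarrow> cmod b < 1"
    unfolding polydisk_def by fastforce+
  show "\<And>j. j \<le> n \<Longrightarrow> (\<lambda>z. elem_sym j (L z)) holomorphic_on ball 0 1"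
    using assms by (simp add: holomorphic_root_family_def)
qed

lemma holomorphic_prod_linear_form:
  assumes L: "holomorphic_root_family n L"
  shows "(\<lambda>z. \<Prod>l\<leftarrow>L z. \<alpha> - \<beta> * l) holomorphic_on ball 0 1"
proof (rule holomorphic_transform)
  fix z :: complex assume "z \<in> ball 0 1"
  then show "(\<Sum>j\<le>n. (- \<beta>) ^ j * elem_sym j (L z) * \<alpha> ^ (n - j)) = (\<Prod>l\<leftarrow>L z. \<alpha> - \<beta> * l)"
    using holomorphic_root_familyD(1)[OF L, of z] by (simp only: prod_list_diff_elem_sym mem_ball_0)
next
  show "(\<lambda>z. \<Sum>j\<le>n. (- \<beta>) ^ j * elem_sym j (L z) * \<alpha> ^ (n - j)) holomorphic_on ball 0 1"
    by (intro holomorphic_intros holomorphic_root_familyD[OF L]) auto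
qed

lemma prod_list_moebius:
  "(\<Prod>l\<leftarrow>zs. moebius b l) = (\<Prod>l\<leftarrow>zs. - b - (- 1) * l) / (\<Prod>l\<leftarrow>zs. 1 - cnj b * l)"
  by (induction zs) (simp_all add: Moebius_function_simple)

lemma holomorphic_prod_moebius:
  assumes L: "holomorphic_root_family n L" and b: "cmod b < 1"
  shows "(\<lambda>z. \<Prod>l\<leftarrow>L z. moebius b l) holomorphic_on ball 0 1"
  unfolding prod_list_moebius
  using moebius_denominator_nonzero[OF b] holomorphic_root_familyD(2)[OF L]
  by (intro holomorphic_on_divide holomorphic_prod_linear_form[OF L]) (auto simp: prod_list_zero_iff)

lemma cmod_prod_list: "cmod (prod_list zs) = (\<Prod>z\<leftarrow>zs. cmod z)"
  by (induction zs) (simp_all add: norm_mult)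

lemma cmod_prod_list_less_1:
  "zs \<noteq> [] \<Longrightarrow> (\<And>z. z \<in> set zs \<Longrightarrow> cmod z < 1) \<Longrightarrow> cmod (prod_list zs) < 1"
proof (induction zs rule: list_nonempty_induct)
  case (cons z zs)
  then show ?case using norm_mult_less[of z 1 "prod_list zs" 1] by simp
qed simp

text \<open>
  A Schwarz lemma for \<open>n\<close>-valued functions. The product of the Moebius transforms \<open>moebius b l\<close> over
  the values \<open>l\<close> at \<open>z\<close> is symmetric in them, hence a single-valued holomorphic self-map of the disc
  in \<open>z\<close>; it vanishes at \<open>x\<close> because \<open>b\<close> is a value there. It therefore competes in the supremum
  that defines the Moebius distance.
\<close>

lemma prod_moebius_dist_le:
  assumes L: "holomorphic_root_family n L" and n: "n \<ge> 1"
    and x: "cmod x < 1" and z: "cmod z < 1" and b: "b \<in> set (L x)"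
  shows "(\<Prod>l\<leftarrow>L z. moebius_dist l b) \<le> moebius_dist z x"
proof -
  let ?\<phi> = "\<lambda>z. \<Prod>l\<leftarrow>L z. moebius b l"
  have b1: "cmod b < 1" using holomorphic_root_familyD(2)[OF L] x b by blast
  have in_disc: "cmod (?\<phi> z) < 1" if "cmod z < 1" for z
    using that n holomorphic_root_familyD(1,2)[OF L that] b1
    by (intro cmod_prod_list_less_1) (auto simp: Moebius_function_norm_lt_1)
  have \<phi>0: "?\<phi> x = 0"
    using b by (auto simp: prod_list_zero_iff image_iff intro!: bexI[of _ b] Moebius_function_eq_zero)
  have "cmod (?\<phi> z) \<le> moebius_dist z x"
    unfolding moebius_dist_def
  proof (intro cSup_upper bdd_aboveI[of _ 1])
    show "cmod (?\<phi> z) \<in> {cmod (\<phi> z) |\<phi>. \<phi> holomorphic_on ball 0 1 \<and> \<phi> ` ball 0 1 \<subseteq> ball 0 1 \<and> \<phi> x = 0}"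
      using holomorphic_prod_moebius[OF L b1] in_disc \<phi>0
      by (intro CollectI exI[of _ ?\<phi>]) (auto simp: image_subset_iff)
  qed (use z in \<open>force simp: image_subset_iff\<close>)
  moreover have "cmod (?\<phi> z) = (\<Prod>l\<leftarrow>L z. moebius_dist l b)"
    using holomorphic_root_familyD(2)[OF L z] b1
    by (auto simp: cmod_prod_list o_def moebius_dist_eq_cmod_moebius intro!: arg_cong[of _ _ prod_list])
  ultimately show ?thesis by simp
qed

lemma prod_list_le_power_imp_eq:
  fixes ys :: "real list"
  assumes "\<And>y. y \<in> set ys \<Longrightarrow> r \<le> y" "0 < r" "prod_list ys \<le> r ^ length ys" "y \<in> set ys"
  shows "y = r"
proof -
  have pw: "r ^ length zs \<le> prod_list zs" if "\<And>y. y \<in> set zs \<Longrightarrow> r \<le> y" for zs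
    using that
  proof (induction zs)
    case (Cons z zs)
    then have "r \<le> z" "r ^ length zs \<le> prod_list zs" by auto
    then show ?case using assms(2) by (auto intro: mult_mono)
  qed simp
  obtain us vs where ys: "ys = us @ y # vs" using assms(4) split_list by metis
  have "r ^ length (us @ vs) \<le> prod_list (us @ vs)" using assms(1) ys by (intro pw) auto
  moreover have "y * prod_list (us @ vs) \<le> r * r ^ length (us @ vs)"
    using assms(3) ys by (simp add: algebra_simps power_add)
  ultimately have "y * r ^ length (us @ vs) \<le> r * r ^ length (us @ vs)"
    using assms(1,2,4) by (smt (verit) mult_left_mono)
  then show ?thesis using assms by fastforce
qed

lemma hausdorff_dist_le_cases:
  assumes AB: "finite A" "A \<noteq> {}" "finite B" "B \<noteq> {}" 
  obtains a where "a \<in> A" "\<And>b. b \<in> B \<Longrightarrow> hausdorff_dist d A B \<le> d a b"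
  | b where "b \<in> B" "\<And>a. a \<in> A \<Longrightarrow> hausdorff_dist d A B \<le> d a b"
proof -
  let ?f = "\<lambda>a. Min ((\<lambda>b. d a b) ` B)" and ?g = "\<lambda>b. Min ((\<lambda>a. d a b) ` A)"
  have "Max (?f ` A) \<in> ?f ` A" "Max (?g ` B) \<in> ?g ` B" using AB by (auto intro!: Max_in)
  then obtain a b where ab: "a \<in> A" "Max (?f ` A) = ?f a" "b \<in> B" "Max (?g ` B) = ?g b" by blast
  have "?f a \<le> d a b'" if "b' \<in> B" for b' using that AB by simp
  moreover have "?g b \<le> d a' b" if "a' \<in> A" for a' using that AB by simp
  ultimately show ?thesis using ab that unfolding hausdorff_dist_def by (smt (verit))
qed

lemma hausdorff_dist_nonneg:
  assumes "finite A" "A \<noteq> {}" "finite B" "B \<noteq> {}" "\<And>a b. a \<in> A \<Longrightarrow> b \<in> B \<Longrightarrow> 0 \<le> d a b"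
  shows "0 \<le> hausdorff_dist d A B"
proof -
  obtain a where a: "a \<in> A" using assms by blast
  have "0 \<le> Min ((\<lambda>b. d a b) ` B)" using assms a by simp
  also have "\<dots> \<le> Max ((\<lambda>a. Min ((\<lambda>b. d a b) ` B)) ` A)" using assms a by simp
  finally show ?thesis by (simp add: hausdorff_dist_def)
qed

text \<open>
  The equation for the Hausdorff distance is the equality case of two instances of the Schwarz lemma
  above, one with base point \<open>x\<close> and one with base point \<open>0\<close>. The distance is attained at a point
  that is at least that far from every point of the other set, while the geometric mean of these
  distances is at most \<open>root n (cmod x)\<close>; so all of them are equal.
\<close>

lemma equidistant_root:
  assumes L: "holomorphic_root_family n L" and n: "n \<ge> 1" and x: "cmod x < 1" "x \<noteq> 0"
    and eq: "hausdorff_dist moebius_dist (set (L x)) (set (L 0)) ^ n = moebius_dist x 0"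
  obtains b where "b \<in> set (L x)" "\<And>a. a \<in> set (L 0) \<Longrightarrow> moebius_dist b a = root n (cmod x)"
  | a where "a \<in> set (L 0)" "\<And>b. b \<in> set (L x) \<Longrightarrow> moebius_dist b a = root n (cmod x)"
proof -
  let ?h = "hausdorff_dist moebius_dist (set (L x)) (set (L 0))" and ?r = "root n (cmod x)"
  have 0: "cmod 0 < 1" by simp
  note D = holomorphic_root_familyD[OF L]
  have dist_x0: "moebius_dist x 0 = cmod x" "moebius_dist 0 x = cmod x"
    using x by (simp_all add: moebius_dist_eq)
  have r: "0 < ?r" "?r ^ n = cmod x" using n x by (auto simp: real_root_pow_pos2)
  have ne: "finite (set (L x))" "set (L x) \<noteq> {}" "finite (set (L 0))" "set (L 0) \<noteq> {}"
    using D(1)[OF x(1)] D(1)[OF 0] n by auto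
  have "0 \<le> ?h"
    using ne D(2)[OF 0] D(2)[OF x(1)] by (intro hausdorff_dist_nonneg) (auto simp: moebius_dist_eq)
  then have hr: "?r \<le> ?h" using eq n dist_x0 real_root_power_cancel[of n ?h] by simp
  consider b where "b \<in> set (L x)" "\<And>a. a \<in> set (L 0) \<Longrightarrow> ?h \<le> moebius_dist b a"
    | a where "a \<in> set (L 0)" "\<And>b. b \<in> set (L x) \<Longrightarrow> ?h \<le> moebius_dist b a"
    using hausdorff_dist_le_cases[OF ne, of moebius_dist] by metis
  then show ?thesis
  proof cases
    case (1 b)
    have "moebius_dist b a = ?r" if a: "a \<in> set (L 0)" for a
    proof (rule prod_list_le_power_imp_eq)
      have "(\<Prod>l\<leftarrow>L 0. moebius_dist b l) = (\<Prod>l\<leftarrow>L 0. moebius_dist l b)"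
        using D(2)[OF 0] D(2)[OF x(1)] 1(1)
        by (auto intro!: arg_cong[of _ _ prod_list] moebius_dist_commute)
      also have "\<dots> \<le> cmod x"
        using prod_moebius_dist_le[OF L n x(1) 0 1(1)] dist_x0 by simp
      finally show "(\<Prod>l\<leftarrow>L 0. moebius_dist b l) \<le> ?r ^ length (map (moebius_dist b) (L 0))"
        using r D(1)[OF 0] by simp
      show "?r \<le> y" if "y \<in> set (map (moebius_dist b) (L 0))" for y
        using that 1(2) hr by fastforce
    qed (use r a in simp_all)
    then show ?thesis using 1(1) that(1) by blast
  next
    case (2 a)
    have "moebius_dist b a = ?r" if b: "b \<in> set (L x)" for b
    proof (rule prod_list_le_power_imp_eq)
      show "(\<Prod>l\<leftarrow>L x. moebius_dist l a) \<le> ?r ^ length (map (\<lambda>l. moebius_dist l a) (L x))"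
        using prod_moebius_dist_le[OF L n 0 x(1) 2(1)] dist_x0 r D(1)[OF x(1)] by simp
      show "?r \<le> y" if "y \<in> set (map (\<lambda>l. moebius_dist l a) (L x))" for y
        using that 2(2) hr by fastforce
    qed (use r b in simp_all)
    then show ?thesis using 2(1) that(2) by blast
  qed
qed

text \<open>
  Applying a Moebius transformation to every value keeps the family holomorphic. By
  \<open>(1 - cnj a * l) * (w - moebius a l) = (w + a) - (1 + cnj a * w) * l\<close>, the polynomial in \<open>w\<close> whose
  roots are the transformed values is, up to the nowhere vanishing factor \<open>\<Prod> (1 - cnj a * l)\<close>, a
  combination of fixed polynomials with the old symmetric functions as coefficients. Comparing
  coefficients expresses the new symmetric functions through the old ones.
\<close>

lemma holomorphic_root_family_moebius:
  assumes L: "holomorphic_root_family n L" and a: "cmod a < 1"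
  shows "holomorphic_root_family n (\<lambda>z. map (moebius a) (L z))"
  unfolding holomorphic_root_family_def
proof (intro conjI allI impI)
  note D = holomorphic_root_familyD[OF L]
  show "(\<lambda>z. map (moebius a) (L z)) ` ball 0 1 \<subseteq> polydisk n"
    using D(1,2) a by (auto simp: polydisk_def Moebius_function_norm_lt_1)
  fix j assume j: "j \<le> n"
  let ?R = "\<lambda>z. \<Prod>l\<leftarrow>L z. 1 - cnj a * l"
  define q where "q i = [:1, cnj a:] ^ i * [:a, 1:] ^ (n - i)" for i
  have q: "poly (q i) w = (1 + cnj a * w) ^ i * (w + a) ^ (n - i)" for i w
    by (simp add: q_def add.commute mult.commute)
  have R0: "?R z \<noteq> 0" if "cmod z < 1" for z
    using D(2)[OF that] moebius_denominator_nonzero[OF a] by (auto simp: prod_list_zero_iff)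
  have "elem_sym j (map (moebius a) (L z)) =
      (\<Sum>i\<le>n. (- 1) ^ i * elem_sym i (L z) * coeff (q i) (n - j)) / ((- 1) ^ j * ?R z)"
    if z: "cmod z < 1" for z
  proof -
    let ?p = "\<Sum>i\<le>n. smult ((- 1) ^ i * elem_sym i (L z)) (q i)"
    let ?p' = "\<Sum>i\<le>n. monom ((- 1) ^ i * elem_sym i (map (moebius a) (L z))) (n - i)"
    have "poly (smult (?R z) ?p') w = poly ?p w" for w
    proof -
      have "poly ?p' w = (\<Prod>l\<leftarrow>L z. w - moebius a l)"
        using prod_list_diff_elem_sym[of w 1 "map (moebius a) (L z)"] D(1)[OF z]
        by (simp add: poly_sum poly_monom o_def)
      moreover have "(\<Prod>l\<leftarrow>ls. 1 - cnj a * l) * (\<Prod>l\<leftarrow>ls. w - moebius a l) =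
          (\<Prod>l\<leftarrow>ls. (1 - cnj a * l) * (w - moebius a l))" for ls
        by (induction ls) (simp_all add: mult_ac)
      then have "?R z * (\<Prod>l\<leftarrow>L z. w - moebius a l) = (\<Prod>l\<leftarrow>L z. (1 - cnj a * l) * (w - moebius a l))"
        by blast
      moreover have "\<dots> = (\<Prod>l\<leftarrow>L z. (w + a) - (1 + cnj a * w) * l)"
      proof (intro arg_cong[of _ _ prod_list] map_cong refl)
        fix l assume "l \<in> set (L z)"
        then have "1 - cnj a * l \<noteq> 0" using D(2)[OF z] moebius_denominator_nonzero[OF a] by blast
        then have "(1 - cnj a * l) * moebius a l = l - a" by (simp add: Moebius_function_simple)
        then show "(1 - cnj a * l) * (w - moebius a l) = (w + a) - (1 + cnj a * w) * l"
          by (simp add: algebra_simps)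
      qed
      moreover have "\<dots> = poly ?p w"
        unfolding prod_list_diff_elem_sym D(1)[OF z] poly_sum power_minus[of "1 + cnj a * w"]
        by (intro sum.cong refl) (simp only: poly_smult q mult_ac)
      ultimately show ?thesis by simp
    qed
    then have "smult (?R z) ?p' = ?p" by (simp add: poly_eq_poly_eq_iff[symmetric] fun_eq_iff)
    from arg_cong[OF this, of "\<lambda>p. coeff p (n - j)"]
    have "?R z * coeff ?p' (n - j) = coeff ?p (n - j)" by (simp only: coeff_smult)
    moreover have "coeff ?p (n - j) = (\<Sum>i\<le>n. (- 1) ^ i * elem_sym i (L z) * coeff (q i) (n - j))"
      by (simp only: coeff_sum coeff_smult)
    moreover have "coeff ?p' (n - j) = (- 1) ^ j * elem_sym j (map (moebius a) (L z))"
    proof -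
      have "coeff ?p' (n - j) =
          (\<Sum>i\<le>n. if i = j then (- 1) ^ i * elem_sym i (map (moebius a) (L z)) else 0)"
        unfolding coeff_sum using j by (intro sum.cong) auto
      then show ?thesis using j by simp
    qed
    ultimately have "?R z * ((- 1) ^ j * elem_sym j (map (moebius a) (L z))) =
        (\<Sum>i\<le>n. (- 1) ^ i * elem_sym i (L z) * coeff (q i) (n - j))" by simp
    then show ?thesis using R0[OF z] by (simp add: eq_divide_eq mult_ac)
  qed
  moreover have "(\<lambda>z. (\<Sum>i\<le>n. (- 1) ^ i * elem_sym i (L z) * coeff (q i) (n - j)) / ((- 1) ^ j * ?R z))
      holomorphic_on ball 0 1"
    using R0 by (intro holomorphic_intros D(3) holomorphic_prod_linear_form[OF L]) auto
  ultimately show "(\<lambda>z. elem_sym j (map (moebius a) (L z))) holomorphic_on ball 0 1"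
    by (auto intro: holomorphic_transform)
qed

section \<open>Families with a single value at the origin\<close>

lemma uniform_limit_sum_mult_const:
  fixes c :: "'i \<Rightarrow> 'a::metric_space \<Rightarrow> complex"
  assumes "finite J" "compact K" "\<And>j. j \<in> J \<Longrightarrow> continuous_on K (c j)"
    and "\<And>j. j \<in> J \<Longrightarrow> (a j \<longlonglongrightarrow> 1)"
  shows "uniform_limit K (\<lambda>k w. \<Sum>j\<in>J. c j w * a j k) (\<lambda>w. \<Sum>j\<in>J. c j w) sequentially"
  using assms(1,3,4)
proof (induction J rule: finite_induct)
  case empty
  show ?case by (simp add: uniform_limit_const)
next
  case (insert i J)
  have a: "uniform_limit K (\<lambda>k w. a i k) (\<lambda>w. 1) sequentially"
  proof (rule uniform_limitI)
    fix e :: real assume "e > 0"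
    with insert.prems(2)[of i] have "\<forall>\<^sub>F k in sequentially. dist (a i k) 1 < e" by (auto dest: tendstoD)
    then show "\<forall>\<^sub>F k in sequentially. \<forall>w\<in>K. dist (a i k) 1 < e" by simp
  qed
  have "bounded (c i ` K)"
    using assms(2) insert.prems(1)[of i] by (intro compact_imp_bounded compact_continuous_image) auto
  moreover have "bounded ((\<lambda>w. 1::complex) ` K)" by (rule bounded_subset[of "{1}"]) auto
  ultimately have "uniform_limit K (\<lambda>k w. c i w * a i k) (\<lambda>w. c i w * 1) sequentially"
    using a by (intro uniform_lim_mult uniform_limit_const) (auto simp: uniform_limit_const)
  from uniform_limit_add[OF this insert.IH] insert show ?case by simp
qed

lemma cmod_root_power_le:
  assumes L: "holomorphic_root_family n L" and n: "n \<ge> 1" and center: "set (L 0) = {0}"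
    and z: "cmod z < 1" and l: "l \<in> set (L z)"
  shows "cmod l ^ n \<le> cmod z"
proof -
  have "length (L 0) = n" using holomorphic_root_familyD(1)[OF L, of 0] by simp
  with center have "L 0 = replicate n 0" by (intro replicate_eqI) auto
  moreover have "cmod l < 1" using holomorphic_root_familyD(2)[OF L z l] .
  ultimately show ?thesis
    using prod_moebius_dist_le[OF L n z _ l, of 0] z by (simp add: moebius_dist_eq)
qed

text \<open>
  A rigidity statement: if all values at \<open>0\<close> coincide with \<open>0\<close> and equality holds in
  \<open>cmod_root_power_le\<close> at one point other than \<open>0\<close>, then the values are the \<open>n\<close>-th roots of \<open>z\<close>, rotated.

  Substitute \<open>z = w ^ n\<close> and consider \<open>\<Prod> (\<tau> * w - l)\<close> over the values \<open>l\<close> at \<open>w ^ n\<close>. Since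
  \<open>cmod l \<le> cmod w\<close>, this function of \<open>w\<close> has no zero in the punctured disc when \<open>cmod \<tau> > 1\<close>. Letting
  \<open>\<tau>\<close> tend radially to the number \<open>v\<close> of modulus one for which equality produces a zero, the theorem
  of Hurwitz forces the limit function to vanish identically: \<open>v * w\<close> is a value at \<open>w ^ n\<close> for every
  \<open>w\<close>.
\<close>

lemma extremal_root_family:
  assumes L: "holomorphic_root_family n L" and n: "n \<ge> 1" and center: "set (L 0) = {0}"
    and x: "cmod x < 1" "x \<noteq> 0" and b: "b \<in> set (L x)" "cmod b ^ n = cmod x"
  obtains v where "cmod v = 1" "\<And>w. cmod w < 1 \<Longrightarrow> v * w \<in> set (L (w ^ n))"
proof -
  note D = holomorphic_root_familyD[OF L]
  have "card {w. w ^ n = x} > 0" using card_nth_roots[of x n] x n by simp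
  then obtain w0 where w0: "w0 ^ n = x" by (metis (mono_tags, lifting) card.empty empty_Collect_eq less_irrefl)
  have pow_disc: "cmod (w ^ n) < 1" if "cmod w < 1" for w :: complex
    using that n by (simp add: norm_power power_less_one_iff)
  have eqn: "cmod w0 = cmod b"
  proof (rule power_eq_imp_eq_base)
    show "cmod w0 ^ n = cmod b ^ n" using w0 b by (simp flip: norm_power)
  qed (use n in auto)
  have w0n: "w0 \<noteq> 0" using w0 x n by (auto simp: power_0_left)
  \<comment> \<open>the unimodular \<open>v\<close> for which the value \<open>b\<close> at \<open>x\<close> is \<open>v * w0\<close>\<close>
  define v where "v = b / w0"
  have v: "cmod v = 1" using eqn w0n by (auto simp: v_def norm_divide)
  let ?S = "ball 0 1 - {0::complex}"
  \<comment> \<open>\<open>g\<close> is the limit of the zero-free \<open>F k\<close>; in terms of the \<open>c j\<close>, the two differ only in powers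
    of the constant \<open>1 + 1 / Suc k\<close>, which gives uniform convergence\<close>
  define c where "c j w = (- 1) ^ j * elem_sym j (L (w ^ n)) * (v * w) ^ (n - j)" for j and w :: complex
  define F where "F k w = (\<Prod>l\<leftarrow>L (w ^ n). (of_real (1 + 1 / Suc k) * (v * w)) - 1 * l)" for k :: nat and w
  define g where "g w = (\<Prod>l\<leftarrow>L (w ^ n). v * w - 1 * l)" for w
  have F_eq: "F k w = (\<Sum>j\<le>n. c j w * of_real (1 + 1 / Suc k) ^ (n - j))" if "w \<in> ball 0 1" for k w
    unfolding F_def prod_list_diff_elem_sym c_def using D(1)[OF pow_disc, of w] that
    by (intro sum.cong) (simp_all add: power_mult_distrib)
  have g_eq: "g w = (\<Sum>j\<le>n. c j w)" if "w \<in> ball 0 1" for w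
    unfolding g_def prod_list_diff_elem_sym c_def using D(1)[OF pow_disc, of w] that by simp
  have hol_c: "c j holomorphic_on ball 0 1" if "j \<le> n" for j
  proof -
    have "(\<lambda>z. elem_sym j (L z)) \<circ> (\<lambda>w. w ^ n) holomorphic_on ball 0 1"
      using pow_disc by (intro holomorphic_on_compose_gen[OF _ D(3)[OF that]] holomorphic_intros) auto
    then show ?thesis unfolding c_def by (intro holomorphic_intros) (auto simp: o_def)
  qed
  have g_zero: "g w = 0 \<longleftrightarrow> v * w \<in> set (L (w ^ n))" for w
    by (auto simp: g_def prod_list_zero_iff)
  have const: "g constant_on ?S"
  proof (rule ccontr)
    assume nonconst: "\<not> g constant_on ?S"
    have "g w0 \<noteq> 0"
    proof (rule Hurwitz_no_zeros[OF _ _ _ _ _ nonconst])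
      show "open ?S" by auto
      show "connected ?S" by (rule connected_open_delete) (auto simp: convex_connected)
      show "F k holomorphic_on ?S" for k
        by (rule holomorphic_transform[of "\<lambda>w. \<Sum>j\<le>n. c j w * of_real (1 + 1 / Suc k) ^ (n - j)"])
          (auto intro!: holomorphic_intros holomorphic_on_subset[OF hol_c] simp: F_eq)
      show "g holomorphic_on ?S"
        by (rule holomorphic_transform[of "\<lambda>w. \<Sum>j\<le>n. c j w"])
          (auto intro!: holomorphic_intros holomorphic_on_subset[OF hol_c] simp: g_eq)
      show "uniform_limit K F g sequentially" if K: "compact K" "K \<subseteq> ?S" for K
      proof -
        have "(\<lambda>k. of_real (1 + 1 / Suc k) ^ m) \<longlonglongrightarrow> (1::complex)" for m
        proof -
          have "(\<lambda>k. 1 / real (Suc k)) \<longlonglongrightarrow> 0"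
            by (rule LIMSEQ_Suc[OF lim_1_over_n])
          then have "(\<lambda>k. of_real (1 + 1 / real (Suc k)) ^ m) \<longlonglongrightarrow> (of_real (1 + 0) ^ m :: complex)"
            by (intro tendsto_intros)
          then show ?thesis by simp
        qed
        then have "uniform_limit K (\<lambda>k w. \<Sum>j\<in>{..n}. c j w * of_real (1 + 1 / Suc k) ^ (n - j))
            (\<lambda>w. \<Sum>j\<in>{..n}. c j w) sequentially"
          using K by (intro uniform_limit_sum_mult_const)
            (auto intro!: holomorphic_on_imp_continuous_on holomorphic_on_subset[OF hol_c])
        then show ?thesis
          using K by (elim uniform_limit_cong'[THEN iffD1, rotated 2]) (auto simp: F_eq g_eq subset_iff)
      qed
      show "F k w \<noteq> 0" if w: "w \<in> ?S" for k w
      proof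
        assume "F k w = 0"
        then have "of_real (1 + 1 / Suc k) * (v * w) \<in> set (L (w ^ n))"
          by (auto simp: F_def prod_list_zero_iff)
        then have "cmod (of_real (1 + 1 / Suc k) * (v * w)) ^ n \<le> cmod w ^ n"
          using cmod_root_power_le[OF L n center pow_disc, of w] w by (simp add: norm_power)
        then have "cmod (of_real (1 + 1 / Suc k) * (v * w)) \<le> cmod w"
          using n by (subst (asm) power_mono_iff) auto
        moreover have "cmod (of_real (1 + 1 / Suc k) * (v * w)) = (1 + 1 / Suc k) * cmod w"
          using v unfolding norm_mult norm_of_real by simp
        ultimately have "1 + 1 / real (Suc k) \<le> 1" using w by simp
        then show False by (simp add: field_simps)
      qed
      show "w0 \<in> ?S"
        using w0n w0 x n by (simp add: norm_power power_less_one_iff flip: w0)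
    qed
    moreover have "v * w0 = b" using w0n by (simp add: v_def)
    ultimately show False using b w0 g_zero by simp
  qed
  have w0S: "w0 \<in> ?S" using w0n w0 x n by (simp add: norm_power power_less_one_iff flip: w0)
  have "v * w \<in> set (L (w ^ n))" if "cmod w < 1" for w
  proof (cases "w = 0")
    case True
    then show ?thesis using center n by (simp add: power_0_left)
  next
    case False
    have "g w0 = 0" using b w0 w0n by (simp add: g_zero v_def)
    moreover obtain C where "\<And>u. u \<in> ?S \<Longrightarrow> g u = C" using const unfolding constant_on_def by blast
    ultimately have "g w = 0" using that False w0S by simp
    then show ?thesis by (simp add: g_zero)
  qed
  with v show ?thesis using that by blast
qed

section \<open>All values at the origin coincide\<close>

lemma holomorphic_constant_if_image_thin:
  assumes "g holomorphic_on V" "open V" "connected V" "g ` V \<subseteq> X" "interior X = {}"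
  shows "g constant_on V"
proof (rule ccontr)
  assume nc: "\<not> g constant_on V"
  then have "open (g ` V)" using open_mapping_thm[of g V V] assms by auto
  then have "g ` V \<subseteq> interior X" using assms(4) by (rule interior_maximal[rotated])
  then have "V = {}" using assms(5) by auto
  with nc show False by (simp add: constant_on_def)
qed

text \<open>
  The hypothesis is what \<open>elem_sym_reflect\<close> yields when all values at \<open>x\<close> have modulus
  \<open>root n (cmod x)\<close>. It makes \<open>E j z * E (n - j) z / (\<omega> * z)\<close> real, hence constant, so that
  \<open>(cmod (E j z))\<^sup>2\<close> is a constant multiple of \<open>root n (cmod z) ^ (2 * j)\<close>. Then \<open>E j z ^ n / z ^ j\<close>
  has constant modulus and is constant too, and \<open>E j z ^ n = C * z ^ j\<close> extends to the origin.
\<close>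

lemma reflection_imp_zero:
  fixes E :: "nat \<Rightarrow> complex \<Rightarrow> complex"
  assumes hol: "\<And>j. j \<le> n \<Longrightarrow> E j holomorphic_on ball 0 1" and n: "n \<ge> 1"
    and V: "open V" "V \<noteq> {}" "V \<subseteq> ball 0 1 - {0}" and \<omega>: "\<omega> \<noteq> 0"
    and refl: "\<And>j x. j \<le> n \<Longrightarrow> x \<in> V \<Longrightarrow>
        cnj (E j x) * (\<omega> * x) = of_real (root n (cmod x) ^ (2 * j)) * E (n - j) x"
    and j: "1 \<le> j" "j \<le> n"
  shows "E j 0 = 0"
proof -
  obtain y \<epsilon> where y: "\<epsilon> > 0" "ball y \<epsilon> \<subseteq> V" using V(1,2) open_contains_ball by blast
  let ?B = "ball y \<epsilon>"
  have B: "?B \<noteq> {}" "?B \<subseteq> ball 0 1" "\<And>z. z \<in> ?B \<Longrightarrow> z \<noteq> 0"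
    using y V(3) by (auto simp: subset_iff)
  define s where "s z = root n (cmod z) ^ (2 * j)" for z :: complex
  have s: "s z > 0" if "z \<in> ?B" for z using B(3)[OF that] n by (simp add: s_def)
  have s_pow: "s z ^ n = cmod z ^ (2 * j)" for z
    using n by (simp add: s_def real_root_pow_pos2 flip: power_mult) (simp add: mult.commute power_mult real_root_pow_pos2)
  let ?h = "\<lambda>z. E j z * E (n - j) z / (\<omega> * z)"
  have h: "?h z = of_real ((cmod (E j z))\<^sup>2 / s z)" if z: "z \<in> ?B" for z
  proof -
    have "E (n - j) z = cnj (E j z) * (\<omega> * z) / of_real (s z)"
      using refl[of j z] s[OF z] j y z B(3)[OF z] by (simp add: s_def field_simps subset_iff)
    then have "?h z = E j z * cnj (E j z) / of_real (s z)" using B(3)[OF z] \<omega> by simp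
    then show ?thesis by (simp only: of_real_divide complex_norm_square)
  qed
  have "?h holomorphic_on ?B"
    using B \<omega> j by (intro holomorphic_intros holomorphic_on_subset[OF hol]) auto
  moreover have "?h ` ?B \<subseteq> {z. \<i> \<bullet> z = 0}" using h by (auto simp: inner_complex_def)
  moreover have "interior {z. \<i> \<bullet> z = 0} = {}" by (rule interior_hyperplane) simp
  ultimately have "?h constant_on ?B"
    by (intro holomorphic_constant_if_image_thin) (auto simp: convex_connected)
  then obtain c where c: "\<And>z. z \<in> ?B \<Longrightarrow> ?h z = c" unfolding constant_on_def by blast
  define r where "r = Re c"
  have r: "(cmod (E j z))\<^sup>2 = r * s z" if "z \<in> ?B" for z
  proof -
    have "c = of_real ((cmod (E j z))\<^sup>2 / s z)" using c[OF that] h[OF that] by simp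
    then have "r = (cmod (E j z))\<^sup>2 / s z" unfolding r_def by simp
    then show ?thesis using s[OF that] by simp
  qed
  let ?k = "\<lambda>z. E j z ^ n / z ^ j"
  have k: "cmod (?k z) = sqrt (r ^ n)" if z: "z \<in> ?B" for z
  proof (rule real_sqrt_unique[symmetric])
    have "(cmod (E j z) ^ n)\<^sup>2 = r ^ n * cmod z ^ (2 * j)"
      using r[OF z] by (metis power_mult_distrib s_pow power_mult mult.commute)
    then show "(cmod (?k z))\<^sup>2 = r ^ n" using B(3)[OF z]
      by (simp add: norm_divide norm_power power_divide mult.commute flip: power_mult)
  qed simp
  have "interior (sphere (0 :: complex) (sqrt (r ^ n))) = {}" 
  proof -
    have "sphere (0 :: complex) (sqrt (r ^ n)) = cball 0 (sqrt (r ^ n)) \<inter> - ball 0 (sqrt (r ^ n))" by auto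
    then have "interior (sphere (0 :: complex) (sqrt (r ^ n))) =
        ball 0 (sqrt (r ^ n)) \<inter> - closure (ball 0 (sqrt (r ^ n)))"
      by (simp only: interior_Int interior_cball interior_complement)
    then show ?thesis using closure_subset by blast
  qed
  moreover have "?k holomorphic_on ?B"
    using B j by (intro holomorphic_intros holomorphic_on_subset[OF hol]) auto
  moreover have "?k ` ?B \<subseteq> sphere 0 (sqrt (r ^ n))" using k by auto
  ultimately have "?k constant_on ?B"
    by (intro holomorphic_constant_if_image_thin) (auto simp: convex_connected)
  then obtain C where C: "\<And>z. z \<in> ?B \<Longrightarrow> ?k z = C" unfolding constant_on_def by blast
  have "E j 0 ^ n = C * 0 ^ j"
  proof (rule analytic_continuation_open[of ?B "ball 0 1" "\<lambda>z. E j z ^ n" "\<lambda>z. C * z ^ j"])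
    show "E j z ^ n = C * z ^ j" if "z \<in> ?B" for z using C[OF that] B(3)[OF that] by (simp add: field_simps)
  qed (use B j in \<open>auto intro!: holomorphic_intros hol convex_connected\<close>)
  then show ?thesis using j n by (auto simp: power_0_left)
qed

lemma interior_Un_closed_empty:
  assumes "finite A" "\<And>a. a \<in> A \<Longrightarrow> closed (S a)" "\<And>a. a \<in> A \<Longrightarrow> interior (S a) = {}" "interior T = {}"
  shows "interior (T \<union> (\<Union>a\<in>A. S a)) = {}"
  using assms(1-3)
proof (induction A rule: finite_induct)
  case (insert a A)
  have "T \<union> (\<Union>a\<in>insert a A. S a) = S a \<union> (T \<union> (\<Union>a\<in>A. S a))" by blast
  then show ?case using interior_closed_Un_empty_interior[of "S a"] insert by simp
qed (use assms(4) in simp)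

lemma infinite_arc:
  fixes y :: complex
  assumes "y \<noteq> 0" "\<delta> > 0"
  shows "infinite (sphere 0 (cmod y) \<inter> ball y \<delta>)"
proof -
  have "y islimpt sphere 0 (cmod y)"
  proof (rule connected_imp_perfect)
    show "sphere (0 :: complex) (cmod y) \<noteq> {x}" for x
    proof
      assume eq: "sphere (0 :: complex) (cmod y) = {x}"
      have "y \<in> {x}" unfolding eq[symmetric] by simp
      moreover have "- y \<in> {x}" unfolding eq[symmetric] by simp
      ultimately have "y = - y" by (metis singletonD)
      then show False using assms(1) by simp
    qed
  qed (auto intro: connected_sphere)
  then show ?thesis using assms(2) by (simp add: islimpt_eq_infinite_ball)
qed

lemma closed_equalizer:
  fixes f g :: "'a::metric_space \<Rightarrow> 'b::real_normed_vector"
  assumes "continuous_on K f" "continuous_on K g" "closed K"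
  shows "closed {x \<in> K. f x = g x}"
  using continuous_closed_preimage_constant[of K "\<lambda>x. f x - g x" 0] assms
  by (auto intro: continuous_intros)

text \<open>
  Suppose that there are two distinct values at \<open>0\<close>. By \<open>equidistant_root\<close>, a small disc \<open>K\<close> in \<open>U\<close>
  away from the origin is covered by the set \<open>T\<close> of points with a value equidistant from all values at
  \<open>0\<close>, and by closed sets \<open>S a\<close> that contain the points all of whose values have the right distance from
  \<open>a\<close>. Since there are finitely many \<open>S a\<close>, it suffices that none of these sets has interior.

  For \<open>T\<close>: on an arc of points of equal modulus, the equidistant values lie in a fixed finite set, so
  one of them, \<open>b\<close>, is a value at infinitely many points of the arc. The identity theorem makes \<open>b\<close> a
  value everywhere, also at \<open>0\<close>, although it has positive distance from all values at \<open>0\<close>.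

  For \<open>S a\<close>: move \<open>a\<close> to the origin. The product of the values is then an extremal of the classical
  Schwarz lemma, hence linear, and \<open>reflection_imp_zero\<close> shows that all values at \<open>0\<close> are equal
  to \<open>a\<close>.
\<close>

lemma root_set_singleton:
  assumes L: "holomorphic_root_family n L" and n: "n \<ge> 1"
    and U: "open U" "U \<noteq> {}" "U \<subseteq> ball 0 1"
    and eq: "\<And>x. x \<in> U \<Longrightarrow> hausdorff_dist moebius_dist (set (L x)) (set (L 0)) ^ n = moebius_dist x 0"
  shows "\<exists>a. set (L 0) = {a}"
proof (rule ccontr)
  assume not_single: "\<not> ?thesis"
  note D = holomorphic_root_familyD[OF L]
  have D0: "length (L 0) = n" "\<And>a. a \<in> set (L 0) \<Longrightarrow> cmod a < 1" using D(1,2)[of 0] by auto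
  then obtain a1 where a1: "a1 \<in> set (L 0)" using n by (cases "L 0") auto
  with not_single obtain a2 where a2: "a2 \<in> set (L 0)" "a1 \<noteq> a2" by blast
  have "U \<noteq> {0}" using U(1) not_open_singleton by blast
  then have "\<not> U \<subseteq> {0}" using U(2) by blast
  then have "U - {0} \<noteq> {}" "open (U - {0})" using U by auto
  then obtain y \<epsilon> where "\<epsilon> > 0" "cball y \<epsilon> \<subseteq> U - {0}" using open_contains_cball by blast
  then obtain K where K: "closed K" "interior K \<noteq> {}" "K \<subseteq> U - {0}"
    by (metis closed_cball interior_cball ball_eq_empty linorder_not_le)
  have Kx: "x \<in> U" "x \<noteq> 0" "cmod x < 1" if "x \<in> K" for x using that K U by auto
  define r where "r x = root n (cmod x)" for x :: complex
  have r: "0 < r x" "r x < 1" "r x ^ n = cmod x" if "x \<in> K" for x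
    using Kx[OF that] n by (auto simp: r_def real_root_pow_pos2)
  define T where "T = {x \<in> K. \<exists>b\<in>set (L x). \<forall>a\<in>set (L 0). moebius_dist b a = r x}"
  define E where "E a j z = elem_sym j (map (moebius a) (L z))" for a j z
  have hol_E: "E a j holomorphic_on ball 0 1" if "a \<in> set (L 0)" "j \<le> n" for a j
    using holomorphic_root_familyD(3)[OF holomorphic_root_family_moebius[OF L D0(2)[OF that(1)]] that(2)]
    unfolding E_def .
  have E_n: "E a n z = (\<Prod>l\<leftarrow>L z. moebius a l)" if "cmod z < 1" for a z
    using elem_sym_length[of "map (moebius a) (L z)"] D(1)[OF that] by (simp add: E_def)
  \<comment> \<open>The requirement on all values at \<open>x\<close> is put in terms of their symmetric functions, which are
    continuous in \<open>x\<close>, to make \<open>S a\<close> closed.\<close>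
  define S where "S a = {x \<in> K. cmod (E a n x) = cmod x} \<inter>
    (\<Inter>j\<in>{..n}. {x \<in> K. cnj (E a j x) * E a n x = of_real (r x ^ (2 * j)) * E a (n - j) x})" for a

  have cover: "K \<subseteq> T \<union> (\<Union>a\<in>set (L 0). S a)"
  proof
    fix x assume x: "x \<in> K"
    note Kx = Kx[OF x]
    from equidistant_root[OF L n Kx(3,2) eq[OF Kx(1)]]
    show "x \<in> T \<union> (\<Union>a\<in>set (L 0). S a)"
    proof cases
      case (1 b)
      then show ?thesis using x by (auto simp: T_def r_def)
    next
      case (2 a)
      let ?zs = "map (moebius a) (L x)"
      have norm: "cmod z = r x" if "z \<in> set ?zs" for z
      proof -
        obtain b where "b \<in> set (L x)" "z = moebius a b" using \<open>z \<in> set ?zs\<close> by auto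
        then show ?thesis
          using 2 moebius_dist_eq_cmod_moebius[OF D0(2)[OF 2(1)] D(2)[OF Kx(3)]] by (simp add: r_def)
      qed
      have len: "length ?zs = n" using D(1)[OF Kx(3)] by simp
      have "map cmod ?zs = replicate n (r x)"
        using norm len by (intro replicate_eqI) auto
      then have "cmod (prod_list ?zs) = cmod x"
        using r(3)[OF x] by (simp only: cmod_prod_list prod_list_replicate)
      then have "cmod (E a n x) = cmod x" by (simp only: E_n[OF Kx(3)])
      moreover have "cnj (E a j x) * E a n x = of_real (r x ^ (2 * j)) * E a (n - j) x" if "j \<le> n" for j
        using elem_sym_reflect[of ?zs "r x" j] norm that len unfolding E_n[OF Kx(3)] unfolding E_def by metis
      ultimately have "x \<in> S a" using x by (simp add: S_def)
      then show ?thesis using 2(1) by blast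
    qed
  qed

  have T: "interior T = {}"
  proof (rule ccontr)
    assume "interior T \<noteq> {}"
    then obtain y \<delta> where y: "\<delta> > 0" "ball y \<delta> \<subseteq> T" by (meson all_not_in_conv mem_interior)
    then have "y \<in> T" using centre_in_ball by blast
    then have yK: "y \<in> K" by (simp add: T_def)
    let ?arc = "sphere 0 (cmod y) \<inter> ball y \<delta>"
    let ?B = "{b. cmod b < 1 \<and> moebius_dist b a1 = r y \<and> moebius_dist b a2 = r y}"
    have "\<exists>b\<in>set (L x). \<forall>a\<in>set (L 0). moebius_dist b a = r y" if "x \<in> ?arc" for x
      using that y(2) by (fastforce simp: T_def r_def)
    then obtain \<beta> where \<beta>: "\<And>x. x \<in> ?arc \<Longrightarrow> \<beta> x \<in> set (L x)"
      "\<And>x a. x \<in> ?arc \<Longrightarrow> a \<in> set (L 0) \<Longrightarrow> moebius_dist (\<beta> x) a = r y" by metis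
    have arc_disc: "cmod x < 1" if "x \<in> ?arc" for x using that Kx(3)[OF yK] by auto
    have "\<beta> ` ?arc \<subseteq> ?B"
      using \<beta> arc_disc D(2) a1 a2 by (intro image_subsetI CollectI) metis
    moreover have "finite ?B"
      using finite_moebius_equidistant[OF D0(2)[OF a1] D0(2)[OF a2(1)] a2(2) r(2)[OF yK]] .
    ultimately have "finite (\<beta> ` ?arc)" by (rule finite_subset)
    then obtain x0 where x0: "x0 \<in> ?arc" "infinite {x \<in> ?arc. \<beta> x = \<beta> x0}"
      using pigeonhole_infinite[OF infinite_arc[OF Kx(2)[OF yK] y(1)], of \<beta>] by blast
    let ?b = "\<beta> x0"
    let ?\<psi> = "\<lambda>z. \<Prod>l\<leftarrow>L z. ?b - 1 * l"
    have zero: "?\<psi> z = 0 \<longleftrightarrow> ?b \<in> set (L z)" for z by (auto simp: prod_list_zero_iff)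
    have "?\<psi> constant_on ball 0 1"
    proof (rule ccontr)
      assume "\<not> ?\<psi> constant_on ball 0 1"
      then have "finite {z \<in> sphere 0 (cmod y). ?\<psi> z = 0}"
        using Kx(3)[OF yK]
        by (intro holomorphic_compact_finite_zeros[OF holomorphic_prod_linear_form[OF L]])
          (auto simp: convex_connected)
      moreover have "{x \<in> ?arc. \<beta> x = \<beta> x0} \<subseteq> {z \<in> sphere 0 (cmod y). ?\<psi> z = 0}"
      proof
        fix x assume "x \<in> {x \<in> ?arc. \<beta> x = \<beta> x0}"
        then have "x \<in> ?arc" "\<beta> x = ?b" by auto
        then show "x \<in> {z \<in> sphere 0 (cmod y). ?\<psi> z = 0}" unfolding zero using \<beta>(1)[of x] by auto
      qed
      ultimately show False using x0(2) finite_subset by blast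
    qed
    then have "?\<psi> 0 = ?\<psi> x0" using arc_disc[OF x0(1)] unfolding constant_on_def by fastforce
    then have b0: "?b \<in> set (L 0)" using zero \<beta>(1)[OF x0(1)] by metis
    then have "moebius_dist ?b ?b = r y" using \<beta>(2)[OF x0(1)] by blast
    then show False using D0(2)[OF b0] r(1)[OF yK] by (simp add: moebius_dist_eq)
  qed

  have S_closed: "closed (S a)" if a: "a \<in> set (L 0)" for a
  proof -
    have cont: "continuous_on K (E a j)" if "j \<le> n" for j
      using holomorphic_on_imp_continuous_on[OF hol_E[OF a that]] Kx(3) by (auto intro: continuous_on_subset)
    have "closed {x \<in> K. cmod (E a n x) = cmod x}"
      using cont K(1) by (intro closed_equalizer continuous_intros) auto
    moreover have "closed {x \<in> K. cnj (E a j x) * E a n x = of_real (r x ^ (2 * j)) * E a (n - j) x}"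
      if "j \<le> n" for j
      unfolding r_def using cont K(1) that n
      by (intro closed_equalizer continuous_intros) auto
    ultimately show ?thesis unfolding S_def by (intro closed_Int closed_INT) auto
  qed

  have S_thin: "interior (S a) = {}" if a: "a \<in> set (L 0)" for a
  proof (rule ccontr)
    assume ne: "interior (S a) \<noteq> {}"
    let ?V = "interior (S a)"
    have V: "x \<in> K" "cmod (E a n x) = cmod x"
      "\<And>j. j \<le> n \<Longrightarrow> cnj (E a j x) * E a n x = of_real (r x ^ (2 * j)) * E a (n - j) x"
      if "x \<in> ?V" for x
      using interior_subset[of "S a"] that by (auto simp: S_def)
    obtain x where x: "x \<in> ?V" using ne by blast
    have Lt1: "cmod (E a n z) < 1" if "cmod z < 1" for z
      unfolding E_n[OF that] using that D(1,2)[OF that] n D0(2)[OF a]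
      by (intro cmod_prod_list_less_1) (auto simp: Moebius_function_norm_lt_1)
    have E0: "E a n 0 = 0"
      using a E_n[of 0 a] Moebius_function_eq_zero[of 0 a] by (force simp: prod_list_zero_iff image_iff)
    obtain \<omega> where \<omega>: "\<And>z. cmod z < 1 \<Longrightarrow> E a n z = \<omega> * z" "cmod \<omega> = 1"
      using Schwarz_Lemma(3)[OF hol_E[OF a order_refl] E0 Lt1, of 0] V(1,2)[OF x] Kx[of x] by auto
    have "E a j 0 = 0" if "1 \<le> j" "j \<le> n" for j
    proof (rule reflection_imp_zero[OF hol_E[OF a] n _ ne _ _ _ that])
      show "?V \<subseteq> ball 0 1 - {0}" using V(1) Kx by auto
      show "\<omega> \<noteq> 0" using \<omega>(2) by auto
      show "cnj (E a j x) * (\<omega> * x) = of_real (root n (cmod x) ^ (2 * j)) * E a (n - j) x"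
        if "j \<le> n" "x \<in> ?V" for j x
        using V(3)[OF that(2,1)] \<omega>(1)[of x] Kx(3)[OF V(1)[OF that(2)]] by (simp add: r_def)
    qed auto
    then have "moebius a b = 0" if "b \<in> set (L 0)" for b
      using eq_0_if_elem_sym_eq_0[of "map (moebius a) (L 0)" "moebius a b"] that D0(1)
      by (simp add: E_def)
    then have "b = a" if "b \<in> set (L 0)" for b
      using that moebius_eq_0_iff D0(2) a by metis
    then show False using a1 a2 by metis
  qed

  have "interior (T \<union> (\<Union>a\<in>set (L 0). S a)) = {}"
    using S_closed S_thin T by (intro interior_Un_closed_empty) auto
  then show False using interior_mono[OF cover] K(2) by blast
qed

section \<open>Recognizing the root multi-function\<close>

theorem theorem3:
  fixes n :: nat and f :: "complex \<Rightarrow> complex list" and U :: "complex set"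
  assumes "n \<ge> 1"
    and "f ` ball 0 1 \<subseteq> sym_polydisk n"
    and "holomorphic_map n f (ball 0 1)"
    and "open U" "U \<noteq> {}" "U \<subseteq> ball 0 1"
    and "\<And>x. x \<in> U \<Longrightarrow>
      (hausdorff_dist moebius_dist (sym_preimage (f x)) (sym_preimage (f 0))) ^ n = moebius_dist x 0"
  shows "\<exists>g. disc_automorphism g \<and>
    (\<forall>z\<in>ball 0 1. \<exists>\<zeta>s\<in>polydisk n. lists_nth_roots n z \<zeta>s \<and> sym_lift g (f z) = sym_map \<zeta>s)"
proof -
  note n = assms(1) and hol_f = assms(3) and U = assms(4-6)
  have "\<exists>zs\<in>polydisk n. f z = sym_map zs" if "z \<in> ball 0 1" for z
    using assms(2) that unfolding sym_polydisk_def by blast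
  then obtain L where LD: "\<And>z. z \<in> ball 0 1 \<Longrightarrow> L z \<in> polydisk n"
    and fL: "\<And>z. z \<in> ball 0 1 \<Longrightarrow> f z = sym_map (L z)" by metis
  have L: "holomorphic_root_family n L"
    unfolding holomorphic_root_family_def
  proof (intro conjI allI impI image_subsetI LD)
    fix j assume j: "j \<le> n"
    show "(\<lambda>z. elem_sym j (L z)) holomorphic_on ball 0 1"
    proof (cases j)
      case (Suc i)
      show ?thesis
      proof (rule holomorphic_transform)
        show "(\<lambda>z. f z ! i) holomorphic_on ball 0 1"
          using hol_f Suc j by (simp add: holomorphic_map_def)
        show "f z ! i = elem_sym j (L z)" if "z \<in> ball 0 1" for z
          using fL[OF that] LD[OF that] Suc j by (simp add: sym_map_def polydisk_def del: upt_Suc)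
      qed
    qed simp
  qed
  note D = holomorphic_root_familyD[OF L]
  have eq: "hausdorff_dist moebius_dist (set (L x)) (set (L 0)) ^ n = moebius_dist x 0" if "x \<in> U" for x
    using assms(7)[OF that] fL LD U(3) that sym_preimage_sym_map[of _ n] by (simp add: subset_iff)
  obtain a where a: "set (L 0) = {a}" using root_set_singleton[OF L n U eq] by blast
  have a1: "cmod a < 1" using D(2)[of 0 a] a by simp
  have "U \<noteq> {0}" using U(1) not_open_singleton by blast
  then have "\<not> U \<subseteq> {0}" using U(2) by blast
  then obtain x where x: "x \<in> U" "x \<noteq> 0" by blast
  then have "cmod x < 1" using U(3) by auto
  with x have x: "x \<in> U" "cmod x < 1" "x \<noteq> 0" by auto
  obtain b where b: "b \<in> set (L x)" "moebius_dist b a = root n (cmod x)"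
    using equidistant_root[OF L n x(2,3) eq[OF x(1)]]
  proof cases
    case (1 b)
    then show ?thesis using that[of b] a by simp
  next
    case (2 a')
    have "hd (L x) \<in> set (L x)" using D(1)[OF x(2)] n by (intro hd_in_set) auto
    then show ?thesis using that[of "hd (L x)"] 2 a by simp
  qed
  \<comment> \<open>move the only value at the origin to \<open>0\<close>\<close>
  define M where "M z = map (moebius a) (L z)" for z
  have M: "holomorphic_root_family n M"
    using holomorphic_root_family_moebius[OF L a1] unfolding M_def .
  note DM = holomorphic_root_familyD[OF M]
  have M0: "set (M 0) = {0}" using a by (simp add: M_def Moebius_function_eq_zero)
  have "cmod (moebius a b) ^ n = cmod x"
    using b(2) moebius_dist_eq_cmod_moebius[OF a1 D(2)[OF x(2) b(1)]] n by (simp add: real_root_pow_pos2)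
  moreover have "moebius a b \<in> set (M x)" using b(1) by (simp add: M_def)
  ultimately obtain v where v: "cmod v = 1" "\<And>w. cmod w < 1 \<Longrightarrow> v * w \<in> set (M (w ^ n))"
    using extremal_root_family[OF M n M0 x(2,3)] by metis
  have v0: "v \<noteq> 0" using v(1) by auto
  define g where "g z = inverse v * moebius a z" for z
  have "\<exists>\<zeta>s\<in>polydisk n. lists_nth_roots n z \<zeta>s \<and> sym_lift g (f z) = sym_map \<zeta>s"
    if z: "z \<in> ball 0 1" for z
  proof -
    have z1: "cmod z < 1" using z by simp
    let ?\<zeta>s = "map g (L z)"
    have \<zeta>s: "?\<zeta>s = map ((*) (inverse v)) (M z)" by (simp add: g_def M_def)
    have len: "length ?\<zeta>s = n" using D(1)[OF z1] by simp
    have "lists_nth_roots n z ?\<zeta>s"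
    proof (cases "z = 0")
      case True
      have "?\<zeta>s = replicate n 0" using \<zeta>s len M0 True by (intro replicate_eqI) auto
      then show ?thesis using True n by (simp add: lists_nth_roots_iff)
    next
      case False
      have "{w. w ^ n = z} \<subseteq> set ?\<zeta>s"
      proof
        fix w assume "w \<in> {w. w ^ n = z}"
        then have w: "z = w ^ n" by simp
        then have "cmod w < 1" using z1 n by (simp add: norm_power power_less_one_iff)
        then have "v * w \<in> set (M z)" using v(2) w by simp
        then show "w \<in> set ?\<zeta>s" unfolding \<zeta>s using v0 by (auto simp: image_iff intro!: bexI[of _ "v * w"])
      qed
      \<comment> \<open>\<open>n\<close> distinct roots among \<open>n\<close> entries leave no room for a repetition or another entry\<close>
      moreover have card: "card {w. w ^ n = z} = n" using card_nth_roots[OF False] n by simp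
      moreover have "card (set ?\<zeta>s) \<le> n" using card_length len by metis
      ultimately have "{w. w ^ n = z} = set ?\<zeta>s" by (intro card_seteq) auto
      moreover from this have "distinct ?\<zeta>s" using card len card_distinct by metis
      ultimately show ?thesis using False n by (simp add: lists_nth_roots_iff)
    qed
    moreover have "?\<zeta>s \<in> polydisk n"
      using len DM(2)[OF z1] v(1) unfolding polydisk_def \<zeta>s by (auto simp: norm_mult norm_inverse)
    moreover have "sym_lift g (f z) = sym_map ?\<zeta>s"
      using fL[OF z] sym_lift_sym_map[OF LD[OF z]] by simp
    ultimately show ?thesis by blast
  qed
  moreover have "disc_automorphism g"
    using disc_automorphism_rotated_moebius[OF a1, of "inverse v"] v(1)
    unfolding g_def by (simp add: norm_inverse)
  ultimately show ?thesis by blast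
qed

end
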